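(* Let $m\ge 2$, let $n$ be an odd integer, and let $r$ be an integer with $n>r\ge 3$. Then $\chi_{la}(A(mK_{n+1},K_{r+1}))=\chi_{la}(A(mK_n,K_r)\vee K_1)=n+1$.
   Context: All graphs are finite and simple. For a graph $G$ with $q$ edges, a local antimagic labeling of $G$ is a bijection $g:E(G)\to\{1,2,\ldots,q\}$ such that $g^+(u)\neq g^+(v)$ for every edge $uv\in E(G)$, where $g^+(u)$ is the sum of $g(e)$ over all edges $e$ incident to $u$. The local antimagic chromatic number $\chi_{la}(G)$ is the minimum, over all local antimagic labelings $g$ of $G$, of the number of distinct values of $g^+$ on $V(G)$. (It is known that every connected graph of order at least 3 has a local antimagic labeling.) For a graph $G$, $G\vee K_1$ is the graph obtained from $G$ by joining a new vertex to every vertex of $G$. For $m\ge 2$ and $n>r\ge 1$, $A(mK_n,K_r)$ denotes the amalgamation of $m$ copies of the complete graph $K_n$ over $K_r$: the simple graph obtained from $m$ copies of $K_n$ by choosing a $K_r$ in each copy and identifying these $m$ copies of $K_r$ into a single $K_r$. Equivalently, it is the join $(mK_{n-r})\vee K_r$, where $mK_{n-r}$ is the disjoint union of $m$ copies of $K_{n-r}$. *)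

theory Defs
  imports Main
begin

record 'a graph =
  verts :: "'a set"
  edges :: "'a set set"

definition simple_graph :: "'a graph \<Rightarrow> bool" where
  "simple_graph G \<longleftrightarrow> finite (verts G) \<and>
     (\<forall>e \<in> edges G. e \<subseteq> verts G \<and> card e = 2)"

definition vertex_sum :: "'a graph \<Rightarrow> ('a set \<Rightarrow> nat) \<Rightarrow> 'a \<Rightarrow> nat" where
  "vertex_sum G g u = (\<Sum>e | e \<in> edges G \<and> u \<in> e. g e)"

definition local_antimagic :: "'a graph \<Rightarrow> ('a set \<Rightarrow> nat) \<Rightarrow> bool" where
  "local_antimagic G g \<longleftrightarrow>
     bij_betw g (edges G) {1..card (edges G)} \<and>
     (\<forall>u v. {u, v} \<in> edges G \<longrightarrow> vertex_sum G g u \<noteq> vertex_sum G g v)"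

text \<open>The infimum is a minimum as soon as some local antimagic labeling exists. A graph without
  one gets the value 0, which no labeling of a finite graph with a vertex attains.\<close>

definition chi_la :: "'a graph \<Rightarrow> nat" where
  "chi_la G = Inf {card (vertex_sum G g ` verts G) | g. local_antimagic G g}"

definition complete_graph :: "nat \<Rightarrow> nat graph" where
  "complete_graph n = \<lparr>verts = {..<n}, edges = {{i, j} | i j. i < n \<and> j < n \<and> i \<noteq> j}\<rparr>"

definition map_graph :: "('a \<Rightarrow> 'b) \<Rightarrow> 'a graph \<Rightarrow> 'b graph" where
  "map_graph f G = \<lparr>verts = f ` verts G, edges = (\<lambda>e. f ` e) ` edges G\<rparr>"

definition copies :: "nat \<Rightarrow> 'a graph \<Rightarrow> (nat \<times> 'a) graph" where
  "copies m G = \<lparr>verts = {..<m} \<times> verts G,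
                 edges = {Pair k ` e | k e. k < m \<and> e \<in> edges G}\<rparr>"

definition join :: "'a graph \<Rightarrow> 'b graph \<Rightarrow> ('a + 'b) graph" where
  "join G H = \<lparr>verts = verts G <+> verts H,
               edges = (\<lambda>e. Inl ` e) ` edges G \<union> (\<lambda>e. Inr ` e) ` edges H \<union>
                       {{Inl u, Inr v} | u v. u \<in> verts G \<and> v \<in> verts H}\<rparr>"

text \<open>In the \<open>k\<close>-th copy of \<open>K\<^sub>n\<close> the chosen \<open>K\<^sub>r\<close> is on the vertices \<open>(k, i)\<close> with \<open>i < r\<close>;
  all copies of such a vertex are identified with \<open>(0, i)\<close>. The edges inside the chosen \<open>K\<^sub>r\<close>'s
  are identified along with their ends, since \<^const>\<open>edges\<close> is a set.\<close>

definition amalgamation :: "nat \<Rightarrow> nat \<Rightarrow> nat \<Rightarrow> (nat \<times> nat) graph" where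
  "amalgamation m n r =
     map_graph (\<lambda>(k, i). if i < r then (0, i) else (k, i)) (copies m (complete_graph n))"

lemma simple_complete_graph: "simple_graph (complete_graph n)"
  by (auto simp: simple_graph_def complete_graph_def)

lemma simple_copies: "simple_graph G \<Longrightarrow> simple_graph (copies m G)"
  by (force simp: simple_graph_def copies_def card_image inj_on_def)

lemma simple_join:
  assumes "simple_graph G" "simple_graph H"
  shows "simple_graph (join G H)"
  using assms by (auto simp: simple_graph_def join_def card_image; blast)

lemma simple_map_graph:
  assumes "simple_graph G" "\<And>e. e \<in> edges G \<Longrightarrow> inj_on f e"
  shows "simple_graph (map_graph f G)"
  using assms by (auto simp: simple_graph_def map_graph_def card_image; blast)

lemma simple_amalgamation: "simple_graph (amalgamation m n r)"
  unfolding amalgamation_def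
  by (rule simple_map_graph[OF simple_copies[OF simple_complete_graph]])
     (auto simp: copies_def complete_graph_def)

end

theory Submission imports Defs begin

text \<open>
  Joining an apex to the amalgamation of \<open>m\<close> copies of \<open>K\<^sub>n\<close> over \<open>K\<^sub>r\<close> enlarges each copy and the
  shared clique by the apex, so both graphs of the theorem are isomorphic
  (\<open>amalgamation_eq_map_graph_join\<close>). They contain a clique on \<open>n + 1\<close> vertices, whose vertex sums
  are distinct, hence at least \<open>n + 1\<close> values occur. What remains is a labeling with only
  \<open>n + 1\<close> values.

  Call the \<open>t = r + 1\<close> shared vertices the core, and let each copy have \<open>s = n - r\<close> further vertices.
  Corresponding vertices of different copies have to get the same sum. The edges outside the core
  fall into classes of \<open>m\<close> corresponding edges, one per copy. If a class receives \<open>m\<close>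
  consecutive labels, increasing or decreasing with the number of the copy, then a vertex sum is the
  same in all copies as soon as equally many classes at that vertex increase and decrease. But the
  degree \<open>s + t - 1 = n\<close> is odd, so this cannot be arranged for all classes at a vertex. Three
  core vertices are therefore set aside. The edges from them to the copies are labeled by the
  columns of a magic rectangle with three rows, one column for each of the \<open>m s\<close> vertices outside
  the core, so that they contribute the same constant to each of these sums. The remaining
  \<open>n - 3\<close> classes at a vertex are even in number, and signs depending on parities balance them
  (\<open>signs_balance\<close>, \<open>copy_sum_eq\<close>). Magic rectangles of this kind need an odd number of columns.
  If \<open>m s\<close> is even, the rectangle gets one more column, and the three labels in it go to edges
  inside the core.

  It remains to separate the \<open>n + 1\<close> sums. The labels are assigned in increasing order to the edges
  inside the copies, the edges from the core to the copies (with the three special core vertices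
  last) and the edges inside the core, apart from the three labels just mentioned. Inside each part
  they follow a colexicographic order. Sums at two vertices of the same
  kind can then be compared edge by edge (\<open>copy_sum_mono\<close>, \<open>core_sum_mono\<close>). Outside the core the
  special edges do not contribute to this comparison, but \<open>r \<ge> 3\<close> leaves a core vertex that is not
  special, whose edges make it strict. Finally, the smallest core
  sum exceeds all sums outside the core (\<open>copy_sum_less_core_sum\<close>).
\<close>

section \<open>Isomorphism invariance\<close>

lemma inj_on_image_edges:
  assumes "simple_graph G" "inj_on f (verts G)"
  shows "inj_on (image f) (edges G)"
  using assms unfolding simple_graph_def
  by (intro inj_onI) (metis inj_on_image_eq_iff)

lemma vertex_sum_map_graph:
  assumes G: "simple_graph G" and inj: "inj_on f (verts G)" and u: "u \<in> verts G"
  shows "vertex_sum (map_graph f G) g (f u) = vertex_sum G (g \<circ> image f) u"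
proof -
  have mem: "f u \<in> f ` e \<longleftrightarrow> u \<in> e" if "e \<in> edges G" for e
    using that G inj u unfolding simple_graph_def by (meson inj_on_image_mem_iff)
  have "{e \<in> edges (map_graph f G). f u \<in> e} = image f ` {e \<in> edges G. u \<in> e}"
    using mem by (auto simp: map_graph_def)
  moreover have "inj_on (image f) {e \<in> edges G. u \<in> e}"
    by (rule inj_on_subset[OF inj_on_image_edges[OF G inj]]) auto
  ultimately show ?thesis
    unfolding vertex_sum_def by (simp add: sum.reindex)
qed

lemma local_antimagic_map_graph:
  assumes G: "simple_graph G" and inj: "inj_on f (verts G)"
    and g: "local_antimagic (map_graph f G) g"
  shows "local_antimagic G (g \<circ> image f)"
  unfolding local_antimagic_def
proof (intro conjI allI impI)
  have bij: "bij_betw (image f) (edges G) (edges (map_graph f G))"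
    using inj_on_image_edges[OF G inj] by (simp add: bij_betw_def map_graph_def)
  then have "card (edges (map_graph f G)) = card (edges G)"
    by (simp add: bij_betw_same_card)
  with bij g show "bij_betw (g \<circ> image f) (edges G) {1..card (edges G)}"
    unfolding local_antimagic_def by (auto intro: bij_betw_trans)
next
  fix u v assume e: "{u, v} \<in> edges G"
  then have uv: "u \<in> verts G" "v \<in> verts G"
    using G unfolding simple_graph_def by auto
  have "{f u, f v} \<in> edges (map_graph f G)"
    using imageI[OF e, of "image f"] by (simp add: map_graph_def)
  with g have "vertex_sum (map_graph f G) g (f u) \<noteq> vertex_sum (map_graph f G) g (f v)"
    unfolding local_antimagic_def by auto
  then show "vertex_sum G (g \<circ> image f) u \<noteq> vertex_sum G (g \<circ> image f) v"
    by (simp add: vertex_sum_map_graph[OF G inj] uv)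
qed

lemma map_graph_inv_into:
  assumes G: "simple_graph G" and inj: "inj_on f (verts G)"
  shows "map_graph (inv_into (verts G) f) (map_graph f G) = G"
proof -
  have "inv_into (verts G) f ` f ` e = e" if "e \<in> edges G" for e
    using that G inj unfolding simple_graph_def by (metis inv_into_image_cancel)
  then show ?thesis
    using inj by (simp add: map_graph_def image_image inv_into_image_cancel)
qed

lemma color_counts_map_graph:
  assumes G: "simple_graph G" and inj: "inj_on f (verts G)"
  shows "{card (vertex_sum (map_graph f G) g ` verts (map_graph f G)) | g.
            local_antimagic (map_graph f G) g}
         \<subseteq> {card (vertex_sum G g ` verts G) | g. local_antimagic G g}"
proof clarify
  fix g assume "local_antimagic (map_graph f G) g"
  then have "local_antimagic G (g \<circ> image f)"
    by (rule local_antimagic_map_graph[OF G inj])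
  moreover have "vertex_sum (map_graph f G) g ` verts (map_graph f G)
               = vertex_sum G (g \<circ> image f) ` verts G"
  proof -
    have "verts (map_graph f G) = f ` verts G"
      by (simp add: map_graph_def)
    then show ?thesis
      by (simp add: image_image vertex_sum_map_graph[OF G inj] cong: image_cong)
  qed
  ultimately show "\<exists>g'. card (vertex_sum (map_graph f G) g ` verts (map_graph f G))
      = card (vertex_sum G g' ` verts G) \<and> local_antimagic G g'"
    by metis
qed

text \<open>Relabeling along an isomorphism only shows that each number of colors attained on the image is
  attained on \<open>G\<close>; the converse is the same fact for the inverse isomorphism.\<close>

lemma chi_la_map_graph:
  assumes G: "simple_graph G" and inj: "inj_on f (verts G)"
  shows "chi_la (map_graph f G) = chi_la G"
proof -
  have "simple_graph (map_graph f G)"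
    using G inj by (intro simple_map_graph) (auto simp: simple_graph_def intro: inj_on_subset)
  moreover have "inj_on (inv_into (verts G) f) (verts (map_graph f G))"
    by (simp add: map_graph_def inj_on_inv_into)
  ultimately have "{card (vertex_sum G g ` verts G) | g. local_antimagic G g}
      \<subseteq> {card (vertex_sum (map_graph f G) g ` verts (map_graph f G)) | g.
            local_antimagic (map_graph f G) g}"
    using color_counts_map_graph[of "map_graph f G" "inv_into (verts G) f"]
    unfolding map_graph_inv_into[OF G inj] by blast
  with color_counts_map_graph[OF G inj] show ?thesis
    unfolding chi_la_def by (intro arg_cong[of _ _ Inf] equalityI)
qed

section \<open>The amalgamation in coordinates\<close>

definition amalgam_vertex :: "nat \<Rightarrow> nat \<Rightarrow> nat \<Rightarrow> nat \<times> nat" where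
  "amalgam_vertex t k a = (if a < t then 0 else k, a)"

lemma snd_amalgam_vertex [simp]: "snd (amalgam_vertex t k a) = a"
  by (simp add: amalgam_vertex_def)

lemma verts_amalgamation:
  assumes "m > 0"
  shows "verts (amalgamation m n t) = {(k, a). k < m \<and> a < n \<and> (a < t \<longrightarrow> k = 0)}"
  using assms
  by (force simp: amalgamation_def map_graph_def copies_def complete_graph_def image_iff
      split: if_splits)

text \<open>Two adjacent vertices never have the same second coordinate, so an edge can be written as
  \<open>(k, a, b)\<close> with \<open>a < b\<close>, where \<open>k\<close> is the copy that contains it. An edge inside the
  shared clique lies in all copies; the condition \<open>b < t \<longrightarrow> k = 0\<close> makes its code unique.\<close>

definition edge_codes :: "nat \<Rightarrow> nat \<Rightarrow> nat \<Rightarrow> (nat \<times> nat \<times> nat) set" where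
  "edge_codes m n t = {(k, a, b). k < m \<and> a < b \<and> b < n \<and> (b < t \<longrightarrow> k = 0)}"

definition coded_edge :: "nat \<Rightarrow> nat \<times> nat \<times> nat \<Rightarrow> (nat \<times> nat) set" where
  "coded_edge t = (\<lambda>(k, a, b). {amalgam_vertex t k a, amalgam_vertex t k b})"

lemma edges_amalgamation:
  assumes "m > 0"
  shows "edges (amalgamation m n t) = coded_edge t ` edge_codes m n t"
proof -
  have proj: "(\<lambda>(k, i). if i < t then (0, i) else (k, i)) = (\<lambda>x. amalgam_vertex t (fst x) (snd x))"
    by (auto simp: amalgam_vertex_def)
  define P where "P = {(k, a, b). k < m \<and> a < n \<and> b < n \<and> a \<noteq> b}"
  have "edges (copies m (complete_graph n)) = (\<lambda>(k, a, b). {(k, a), (k, b)}) ` P" (is "?L = ?R")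
  proof
    show "?L \<subseteq> ?R"
    proof
      fix e assume "e \<in> ?L"
      then obtain k a b where "k < m" "a < n" "b < n" "a \<noteq> b" "e = {(k, a), (k, b)}"
        by (auto simp: copies_def complete_graph_def)
      then show "e \<in> ?R"
        by (intro image_eqI[of _ _ "(k, a, b)"]) (auto simp: P_def)
    qed
    show "?R \<subseteq> ?L"
    proof
      fix e assume "e \<in> ?R"
      then obtain k a b where *: "k < m" "a < n" "b < n" "a \<noteq> b" "e = {(k, a), (k, b)}"
        by (auto simp: P_def)
      then have "e = Pair k ` {a, b}" "{a, b} \<in> edges (complete_graph n)"
        by (auto simp: complete_graph_def)
      with \<open>k < m\<close> show "e \<in> ?L"
        unfolding copies_def by auto
    qed
  qed
  then have "edges (amalgamation m n t) = coded_edge t ` P"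
    unfolding amalgamation_def map_graph_def proj
    by (simp add: image_image split_def coded_edge_def)
  also have "\<dots> = coded_edge t ` edge_codes m n t" (is "?L = ?R")
  proof
    have *: "coded_edge t (k, a, b) \<in> ?R" if *: "k < m" "a < n" "b < n" "a < b" for k a b
    proof -
      have "coded_edge t (k, a, b) = coded_edge t (if b < t then 0 else k, a, b)"
        using * by (auto simp: coded_edge_def amalgam_vertex_def)
      moreover have "(if b < t then 0 else k, a, b) \<in> edge_codes m n t"
        using * by (auto simp: edge_codes_def)
      ultimately show ?thesis by (metis imageI)
    qed
    have "coded_edge t (k, a, b) = coded_edge t (k, b, a)" for k a b
      by (auto simp: coded_edge_def)
    with * show "?L \<subseteq> ?R"
      unfolding P_def by clarify (metis linorder_neqE_nat)
    show "?R \<subseteq> ?L"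
      by (intro image_mono) (auto simp: P_def edge_codes_def)
  qed
  finally show ?thesis .
qed

lemma inj_on_coded_edge: "inj_on (coded_edge t) (edge_codes m n t)"
  by (auto simp: inj_on_def coded_edge_def edge_codes_def amalgam_vertex_def doubleton_eq_iff
      split: if_splits)

lemma finite_edge_codes [simp]: "finite (edge_codes m n t)"
  by (rule finite_subset[of _ "{..<m} \<times> {..<n} \<times> {..<n}"]) (auto simp: edge_codes_def)

definition code_labeling ::
  "nat \<Rightarrow> nat \<Rightarrow> nat \<Rightarrow> (nat \<times> nat \<times> nat \<Rightarrow> 'a) \<Rightarrow> (nat \<times> nat) set \<Rightarrow> 'a" where
  "code_labeling m n t f = f \<circ> inv_into (edge_codes m n t) (coded_edge t)"

lemma vertex_sum_code_labeling:
  assumes "m > 0"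
  shows "vertex_sum (amalgamation m n t) (code_labeling m n t f) u
       = (\<Sum>x | x \<in> edge_codes m n t \<and> u \<in> coded_edge t x. f x)"
proof -
  have "{e \<in> edges (amalgamation m n t). u \<in> e}
      = coded_edge t ` {x \<in> edge_codes m n t. u \<in> coded_edge t x}"
    by (auto simp: edges_amalgamation[OF assms])
  moreover have "inj_on (coded_edge t) {x \<in> edge_codes m n t. u \<in> coded_edge t x}"
    by (rule inj_on_subset[OF inj_on_coded_edge]) auto
  ultimately show ?thesis
    unfolding vertex_sum_def code_labeling_def
    by (auto simp: sum.reindex inv_into_f_f[OF inj_on_coded_edge] intro!: sum.cong)
qed

definition sym_label :: "(nat \<times> nat \<times> nat \<Rightarrow> nat) \<Rightarrow> nat \<Rightarrow> nat \<Rightarrow> nat \<Rightarrow> nat" where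
  "sym_label f k a b = f (k, min a b, max a b)"

lemma vertex_sum_copy:
  assumes k: "k < m" and b: "t \<le> b" "b < n"
  shows "vertex_sum (amalgamation m n t) (code_labeling m n t f) (k, b)
       = (\<Sum>a\<in>{..<n} - {b}. sym_label f k a b)"
proof -
  have "{x \<in> edge_codes m n t. (k, b) \<in> coded_edge t x}
      = (\<lambda>a. (k, min a b, max a b)) ` ({..<n} - {b})" (is "?L = ?R")
  proof
    show "?L \<subseteq> ?R"
      using k b
      by (force simp: edge_codes_def coded_edge_def amalgam_vertex_def image_iff min_def max_def
          split: if_splits)
    show "?R \<subseteq> ?L"
      using k b by (auto simp: edge_codes_def coded_edge_def amalgam_vertex_def min_def max_def
          split: if_splits)
  qed
  moreover have "inj_on (\<lambda>a. (k, min a b, max a b)) ({..<n} - {b})"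
    by (auto simp: inj_on_def min_def max_def split: if_splits)
  ultimately show ?thesis
    using k by (simp add: vertex_sum_code_labeling sum.reindex sym_label_def)
qed

lemma vertex_sum_core:
  assumes m: "m > 0" and a: "a < t" and t: "t \<le> n"
  shows "vertex_sum (amalgamation m n t) (code_labeling m n t f) (0, a)
       = (\<Sum>b\<in>{..<t} - {a}. sym_label f 0 a b) + (\<Sum>(k, b)\<in>{..<m} \<times> {t..<n}. f (k, a, b))"
proof -
  let ?p = "\<lambda>b. (0 :: nat, min a b, max a b)" and ?q = "\<lambda>(k, b). (k, a, b)"
  have "{x \<in> edge_codes m n t. (0, a) \<in> coded_edge t x}
      = ?p ` ({..<t} - {a}) \<union> ?q ` ({..<m} \<times> {t..<n})" (is "?L = ?R")
  proof
    show "?L \<subseteq> ?R"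
    proof clarify
      fix k x y assume *: "(k, x, y) \<in> edge_codes m n t" "(0, a) \<in> coded_edge t (k, x, y)"
        "(k, x, y) \<notin> ?q ` ({..<m} \<times> {t..<n})"
      then have "y < t" "k = 0" "x < y" "a = x \<or> a = y"
        using a by (force simp: edge_codes_def coded_edge_def amalgam_vertex_def split: if_splits)+
      then show "(k, x, y) \<in> ?p ` ({..<t} - {a})"
        by (intro image_eqI[of _ _ "if a = x then y else x"]) auto
    qed
    show "?R \<subseteq> ?L"
      using m a t by (auto simp: edge_codes_def coded_edge_def amalgam_vertex_def min_def max_def)
  qed
  moreover have "?p ` ({..<t} - {a}) \<inter> ?q ` ({..<m} \<times> {t..<n}) = {}"
    using a by auto
  moreover have "inj_on ?p ({..<t} - {a})" "inj_on ?q ({..<m} \<times> {t..<n})"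
    by (auto simp: inj_on_def min_def max_def split: if_splits)
  ultimately show ?thesis
    using m by (simp add: vertex_sum_code_labeling sum.union_disjoint sum.reindex sym_label_def
        split_def)
qed

lemma card_edges_amalgamation:
  "m > 0 \<Longrightarrow> card (edges (amalgamation m n t)) = card (edge_codes m n t)"
  by (simp add: edges_amalgamation card_image inj_on_coded_edge)

lemma bij_betw_code_labeling:
  assumes "m > 0" and "bij_betw f (edge_codes m n t) {1..card (edge_codes m n t)}"
  shows "bij_betw (code_labeling m n t f) (edges (amalgamation m n t))
           {1..card (edges (amalgamation m n t))}"
  unfolding code_labeling_def
proof (rule bij_betw_trans)
  show "bij_betw (inv_into (edge_codes m n t) (coded_edge t)) (edges (amalgamation m n t))
          (edge_codes m n t)"
    by (simp add: edges_amalgamation assms(1) bij_betw_inv_into inj_on_imp_bij_betw inj_on_coded_edge)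
qed (use assms in \<open>simp add: card_edges_amalgamation\<close>)

text \<open>The \<open>n\<close> vertices of copy \<open>0\<close> are pairwise adjacent.\<close>

lemma chi_la_amalgamation_ge:
  assumes m: "m > 0" and g: "local_antimagic (amalgamation m n t) g"
  shows "n \<le> card (vertex_sum (amalgamation m n t) g ` verts (amalgamation m n t))"
proof -
  let ?G = "amalgamation m n t"
  have "inj_on (\<lambda>a. vertex_sum ?G g (0, a)) {..<n}"
  proof (rule linorder_inj_onI)
    fix a b assume "a < b" "a \<in> {..<n}" "b \<in> {..<n}"
    then have "(0, a, b) \<in> edge_codes m n t"
      using m by (simp add: edge_codes_def)
    then have "coded_edge t (0, a, b) \<in> edges ?G"
      by (simp add: edges_amalgamation[OF m])
    then have "{(0, a), (0, b)} \<in> edges ?G"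
      by (simp add: coded_edge_def amalgam_vertex_def)
    with g show "vertex_sum ?G g (0, a) \<noteq> vertex_sum ?G g (0, b)"
      unfolding local_antimagic_def by blast
  qed auto
  then have "n = card ((\<lambda>a. vertex_sum ?G g (0, a)) ` {..<n})"
    by (simp add: card_image)
  also have "\<dots> \<le> card (vertex_sum ?G g ` verts ?G)"
    using m simple_amalgamation[of m n t]
    by (intro card_mono) (auto simp: simple_graph_def verts_amalgamation)
  finally show ?thesis .
qed

text \<open>If the sum at a vertex depends only on its second coordinate, and injectively so, then the
  coloring is proper, because adjacent vertices differ in that coordinate, and it meets the lower
  bound given by the clique.\<close>

lemma chi_la_amalgamation_eqI:
  assumes m: "m > 0"
    and f: "bij_betw f (edge_codes m n t) {1..card (edge_codes m n t)}"
    and w: "\<And>k a. (k, a) \<in> verts (amalgamation m n t) \<Longrightarrow>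
              vertex_sum (amalgamation m n t) (code_labeling m n t f) (k, a) = w a"
    and inj: "inj_on w {..<n}"
  shows "chi_la (amalgamation m n t) = n"
proof -
  let ?G = "amalgamation m n t" and ?g = "code_labeling m n t f"
  have "vertex_sum ?G ?g u \<noteq> vertex_sum ?G ?g v" if "{u, v} \<in> edges ?G" for u v
  proof -
    obtain x where x: "x \<in> edge_codes m n t" "{u, v} = coded_edge t x"
      using \<open>{u, v} \<in> edges ?G\<close> by (auto simp: edges_amalgamation[OF m])
    then have "snd u \<noteq> snd v" "snd u < n" "snd v < n"
      by (auto simp: edge_codes_def coded_edge_def doubleton_eq_iff)
    moreover have "u \<in> verts ?G" "v \<in> verts ?G"
      using that simple_amalgamation[of m n t] unfolding simple_graph_def by blast+
    ultimately show ?thesis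
      using w[of "fst u" "snd u"] w[of "fst v" "snd v"] inj by (auto simp: inj_on_def)
  qed
  then have g: "local_antimagic ?G ?g"
    using bij_betw_code_labeling[OF m f] unfolding local_antimagic_def by blast
  have "vertex_sum ?G ?g ` verts ?G \<subseteq> w ` {..<n}"
    using w by (auto simp: verts_amalgamation[OF m])
  then have "card (vertex_sum ?G ?g ` verts ?G) \<le> n"
    by (metis card_image card_lessThan card_mono finite_imageI finite_lessThan inj)
  then have "card (vertex_sum ?G ?g ` verts ?G) = n"
    using chi_la_amalgamation_ge[OF m g] by simp
  from this[symmetric] have "n \<in> {card (vertex_sum ?G g ` verts ?G) | g. local_antimagic ?G g}"
    using g by blast
  then show ?thesis
    unfolding chi_la_def
    by (intro cInf_eq_minimum) (auto simp: chi_la_amalgamation_ge[OF m])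
qed

text \<open>The apex becomes the vertex \<open>(0, 0)\<close> of the enlarged shared clique, and all other second
  coordinates move up by one.\<close>

lemma amalgamation_eq_map_graph_join:
  assumes m: "m > 0" and r: "r < n"
  defines "f \<equiv> case_sum (\<lambda>(k, a). (k, Suc a)) (\<lambda>_. (0, 0))"
  shows "amalgamation m (n + 1) (r + 1)
           = map_graph f (join (amalgamation m n r) (complete_graph 1))"
    and "inj_on f (verts (join (amalgamation m n r) (complete_graph 1)))"
proof -
  let ?G = "amalgamation m n r"
  show "inj_on f (verts (join ?G (complete_graph 1)))"
    by (auto simp: inj_on_def join_def complete_graph_def f_def)
  have verts: "verts (amalgamation m (n + 1) (r + 1)) = f ` verts (join ?G (complete_graph 1))"
  proof -
    have "f ` verts (join ?G (complete_graph 1)) = insert (0, 0) ((\<lambda>(k, a). (k, Suc a)) ` verts ?G)"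
      by (auto simp: join_def complete_graph_def f_def Plus_def image_Un image_image)
    also have "\<dots> = verts (amalgamation m (n + 1) (r + 1))" (is "?L = ?R")
    proof
      show "?L \<subseteq> ?R"
        using m by (auto simp: verts_amalgamation)
      show "?R \<subseteq> ?L"
      proof clarify
        fix k a assume *: "(k, a) \<in> ?R" "(k, a) \<notin> (\<lambda>(k, a). (k, Suc a)) ` verts ?G"
        then have "a = 0"
          using m by (cases a) (auto simp: verts_amalgamation image_iff)
        with * m show "k = 0 \<and> a = 0"
          by (simp add: verts_amalgamation)
      qed
    qed
    finally show ?thesis ..
  qed
  have shift: "coded_edge (r + 1) (k, Suc a, Suc b) = f ` Inl ` coded_edge r (k, a, b)" for k a b
    by (simp add: coded_edge_def amalgam_vertex_def f_def)
  have apex: "coded_edge (r + 1) (k, 0, Suc b) = f ` {Inl (k, b), Inr 0}"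
    if "(k, b) \<in> verts ?G" for k b
    using that by (auto simp: coded_edge_def amalgam_vertex_def f_def verts_amalgamation[OF m])
  have codes: "edge_codes m (n + 1) (r + 1)
      = (\<lambda>(k, a, b). (k, Suc a, Suc b)) ` edge_codes m n r
        \<union> (\<lambda>(k, b). (k, 0, Suc b)) ` verts ?G" (is "?L = ?R")
  proof
    show "?L \<subseteq> ?R"
    proof clarify
      fix k a b assume *: "(k, a, b) \<in> edge_codes m (n + 1) (r + 1)"
        "(k, a, b) \<notin> (\<lambda>(k, b). (k, 0, Suc b)) ` verts ?G"
      then obtain a' b' where "a = Suc a'" "b = Suc b'"
        using m by (cases a; cases b) (auto simp: edge_codes_def verts_amalgamation image_iff)
      with * show "(k, a, b) \<in> (\<lambda>(k, a, b). (k, Suc a, Suc b)) ` edge_codes m n r"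
        by (force simp: edge_codes_def image_iff)
    qed
    show "?R \<subseteq> ?L"
      using m by (auto simp: edge_codes_def verts_amalgamation)
  qed
  have "edges (join ?G (complete_graph 1))
      = (image Inl \<circ> coded_edge r) ` edge_codes m n r \<union> (\<lambda>v. {Inl v, Inr 0}) ` verts ?G"
    by (auto simp: join_def complete_graph_def edges_amalgamation[OF m])
  then have "image f ` edges (join ?G (complete_graph 1))
      = (\<lambda>x. f ` Inl ` coded_edge r x) ` edge_codes m n r
        \<union> (\<lambda>v. f ` {Inl v, Inr 0}) ` verts ?G"
    by (simp only: image_Un image_image comp_def)
  moreover have "coded_edge (r + 1) ` (\<lambda>(k, a, b). (k, Suc a, Suc b)) ` edge_codes m n r
      = (\<lambda>x. f ` Inl ` coded_edge r x) ` edge_codes m n r"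
    unfolding image_image by (intro image_cong) (auto simp only: split_paired_all case_prod_conv shift)
  moreover have "coded_edge (r + 1) ` (\<lambda>(k, b). (k, 0, Suc b)) ` verts ?G
      = (\<lambda>v. f ` {Inl v, Inr 0}) ` verts ?G"
    unfolding image_image by (intro image_cong) (auto simp only: split_paired_all case_prod_conv apex)
  ultimately have "edges (amalgamation m (n + 1) (r + 1))
      = image f ` edges (join ?G (complete_graph 1))"
    by (simp only: edges_amalgamation[OF m] codes image_Un)
  with verts show "amalgamation m (n + 1) (r + 1)
      = map_graph f (join ?G (complete_graph 1))"
    by (simp add: map_graph_def)
qed

section \<open>Colexicographic ranks of pairs\<close>

text \<open>The position of the pair \<open>a < b\<close> when pairs are sorted by their maximum first. Any order that
  is monotone in both entries would make the sums comparable edge by edge; this one also lists the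
  pairs below \<open>n\<close> as an initial segment for all \<open>n\<close>, and it starts with the three edges of a
  triangle, so that a vertex is incident to at most two of the first three.\<close>

definition colex :: "nat \<Rightarrow> nat \<Rightarrow> nat" where
  "colex a b = (b choose 2) + a"

lemma choose_two_mono: "m \<le> n \<Longrightarrow> m choose 2 \<le> n choose 2"
  by (induction rule: dec_induct) (simp_all add: numeral_2_eq_2)

lemma colex_less_choose:
  assumes "a < b" "b < n"
  shows "colex a b < n choose 2"
proof -
  have "colex a b < Suc b choose 2"
    using assms by (simp add: colex_def numeral_2_eq_2)
  also have "\<dots> \<le> n choose 2"
    using assms by (intro choose_two_mono) simp
  finally show ?thesis .
qed

lemma colex_mono_max:
  assumes "a < b" "b < b'"
  shows "colex a b < colex a' b'"
  using colex_less_choose[OF assms] by (simp add: colex_def)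

lemma colex_inject:
  assumes "a < b" "a' < b'" "colex a b = colex a' b'"
  shows "a = a' \<and> b = b'"
proof -
  have "b = b'"
    using assms colex_mono_max[of a b b' a'] colex_mono_max[of a' b' b a] by (metis nat_neq_iff)
  with assms show ?thesis by (simp add: colex_def)
qed

text \<open>With labels that grow with the rank, this makes the labels at \<open>x\<close> smaller than those at \<open>y\<close>,
  neighbor by neighbor.\<close>

lemma colex_mono:
  assumes "x < y" "z \<noteq> x" "z \<noteq> y"
  shows "colex (min x z) (max x z) < colex (min y z) (max y z)"
proof (cases "z < y")
  case True
  with assms show ?thesis
    by (intro less_le_trans[OF colex_mono_max[of _ _ y]]) (auto simp: min_def max_def)
next
  case False
  with assms show ?thesis by (simp add: colex_def)
qed

lemma card_ordered_pairs: "card {(a, b). a < b \<and> b < n} = n choose 2"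
proof (induction n)
  case (Suc n)
  have "{(a, b). a < b \<and> b < Suc n} = {(a, b). a < b \<and> b < n} \<union> (\<lambda>a. (a, n)) ` {..<n}"
    by (auto simp: less_Suc_eq)
  moreover have "finite {(a, b). a < b \<and> b < n}"
    by (rule finite_subset[of _ "{..<n} \<times> {..<n}"]) auto
  ultimately show ?case
    using Suc by (simp add: card_Un_disjoint disjoint_iff image_iff card_image inj_on_def
        numeral_2_eq_2)
qed (simp add: numeral_2_eq_2)

section \<open>A magic rectangle with three rows\<close>

text \<open>Row \<open>\<rho> \<in> {0, 1, 2}\<close> of a \<open>3 \<times> (2h + 1)\<close> array. Each row is a permutation of \<open>{0..2h}\<close> and all
  columns have the sum \<open>3h\<close>: in the last two rows the entries at even \<open>x\<close> fall from \<open>h\<close> and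
  \<open>2h\<close>, those at odd \<open>x\<close> from \<open>2h\<close> and \<open>h - 1\<close>, in both rows by one from each such entry to the
  next, which offsets the growth of the first row. Adding \<open>\<rho> (2h + 1)\<close> to row \<open>\<rho>\<close> gives the usual
  magic rectangle.\<close>

definition magic_row :: "nat \<Rightarrow> nat \<Rightarrow> nat \<Rightarrow> nat" where
  "magic_row h \<rho> x =
     (if \<rho> = 0 then x
      else if \<rho> = 1 then (if even x then h else 2 * h) - x div 2
      else (if even x then 2 * h else h - 1) - x div 2)"

lemma magic_row_le: "x \<le> 2 * h \<Longrightarrow> magic_row h \<rho> x \<le> 2 * h"
  by (auto simp: magic_row_def)

lemma magic_row_sum:
  assumes "x \<le> 2 * h"
  shows "magic_row h 0 x + magic_row h 1 x + magic_row h 2 x = 3 * h"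
proof (cases "even x")
  case True
  then obtain y where "x = 2 * y" by (auto elim: evenE)
  with assms show ?thesis by (simp add: magic_row_def)
next
  case False
  then obtain y where "x = 2 * y + 1" by (auto elim: oddE)
  with assms show ?thesis by (simp add: magic_row_def)
qed

lemma magic_row_inject:
  assumes "x \<le> 2 * h" "y \<le> 2 * h" "magic_row h \<rho> x = magic_row h \<rho> y"
  shows "x = y"
proof (cases "even x"; cases "even y")
  assume "even x" "even y"
  then obtain x' y' where "x = 2 * x'" "y = 2 * y'" by (auto elim!: evenE)
  with assms show ?thesis by (auto simp: magic_row_def split: if_splits)
next
  assume "even x" "odd y"
  then obtain x' y' where "x = 2 * x'" "y = 2 * y' + 1" by (auto elim!: evenE oddE)
  with assms show ?thesis by (auto simp: magic_row_def split: if_splits)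
next
  assume "odd x" "even y"
  then obtain x' y' where "x = 2 * x' + 1" "y = 2 * y'" by (auto elim!: evenE oddE)
  with assms show ?thesis by (auto simp: magic_row_def split: if_splits)
next
  assume "odd x" "odd y"
  then obtain x' y' where "x = 2 * x' + 1" "y = 2 * y' + 1" by (auto elim!: oddE)
  with assms show ?thesis by (auto simp: magic_row_def split: if_splits)
qed

section \<open>The labeling\<close>

lemma block_less:
  fixes m :: nat
  assumes "x < m" "p < q"
  shows "m * p + x < m * q + y"
proof -
  have "m * p + x < m * (p + 1)" using assms by simp
  also have "\<dots> \<le> m * q" using assms by (intro mult_le_mono2) simp
  finally show ?thesis by simp
qed

lemma block_inject:
  fixes m :: nat
  assumes "x < m" "y < m" "m * p + x = m * q + y"
  shows "p = q" "x = y"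
proof -
  show "p = q"
    using assms block_less[of x m p q y] block_less[of y m q p x] by (metis nat_neq_iff)
  then show "x = y" using assms by simp
qed

text \<open>Compares the sums at two adjacent vertices \<open>a\<close> and \<open>b\<close>: the value \<open>f b = g a\<close> of the edge
  between them occurs in both.\<close>

lemma sum_Diff_singleton_mono:
  fixes f g :: "'a \<Rightarrow> 'b :: ordered_comm_monoid_add"
  assumes "finite A" "a \<in> A" "b \<in> A" "a \<noteq> b" "f b = g a"
    and "\<And>x. x \<in> A \<Longrightarrow> x \<noteq> a \<Longrightarrow> x \<noteq> b \<Longrightarrow> f x \<le> g x"
  shows "sum f (A - {a}) \<le> sum g (A - {b})"
proof -
  have "sum f (A - {a}) = f b + sum f (A - {a} - {b})"
    using assms by (intro sum.remove) auto
  also have "\<dots> \<le> g a + sum g (A - {a} - {b})"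
    using assms by (intro add_mono sum_mono) auto
  also have "A - {a} - {b} = A - {b} - {a}"
    by auto
  also have "g a + sum g (A - {b} - {a}) = sum g (A - {b})"
    using assms by (intro sum.remove[symmetric]) auto
  finally show ?thesis .
qed

text \<open>The core has \<open>d\<close> ordinary vertices \<open>0, \<dots>, d - 1\<close> and the three special vertices
  \<open>d, d + 1, d + 2\<close>; each of the \<open>m\<close> copies has \<open>s\<close> more. Outside the core, a vertex has \<open>s - 1\<close>
  neighbors in its copy and \<open>d\<close> ordinary core neighbors, and \<open>parity\<close> says that this is an even
  number in total.\<close>

locale amalgam_labeling =
  fixes m d s :: nat
  assumes m_pos: "0 < m" and d_pos: "0 < d" and s_pos: "0 < s" and parity: "odd (s + d)"
begin

abbreviation t :: nat where "t \<equiv> d + 3"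
abbreviation n :: nat where "n \<equiv> d + 3 + s"

lemma copy_index_less: "t \<le> b \<Longrightarrow> b < n \<Longrightarrow> b - t < s"
  by simp

lemma copy_index_mono: "t \<le> a \<Longrightarrow> a < b \<Longrightarrow> a - t < b - t"
  by simp

text \<open>The rectangle has \<open>2h + 1\<close> columns, the least odd number that is at least \<open>m s\<close>.\<close>

definition h :: nat where "h = m * s div 2"

text \<open>The place in copy \<open>k\<close> of an ascending or descending class of \<open>m\<close> consecutive labels.\<close>

definition shift :: "bool \<Rightarrow> nat \<Rightarrow> nat" where
  "shift up k = (if up then k else m - 1 - k)"

abbreviation inner_total :: nat where "inner_total \<equiv> m * (s choose 2)"
abbreviation base :: nat where "base \<equiv> inner_total + m * (d * s)"

text \<open>Labels are counted from \<open>0\<close> until \<open>label\<close> adds one, and the vertices of a copy outside the core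
  are numbered from \<open>0\<close>.\<close>

definition inner_label :: "nat \<Rightarrow> nat \<Rightarrow> nat \<Rightarrow> nat" where
  "inner_label k i j = m * colex i j + shift (even (i + j)) k"

text \<open>Direction of the class of edges from core vertex \<open>a\<close> to vertex \<open>j\<close> of the copies. The
  classes inside the copies ascend if the indices of their ends have the same parity, so at vertex
  \<open>j\<close> the ascending ones minus the descending ones are \<open>- 1\<close> for even \<open>s\<close>, and for odd \<open>s\<close> they
  are \<open>0\<close> or \<open>- 2\<close> as \<open>j\<close> is even or odd. Alternating directions at the \<open>d\<close> ordinary core
  vertices compensate this, except for the last case, where the class at \<open>a = 1\<close> is turned around.\<close>

definition ascending :: "nat \<Rightarrow> nat \<Rightarrow> bool" where
  "ascending a j \<longleftrightarrow> even a \<or> a = 1 \<and> odd s \<and> odd j"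

definition ordinary_label :: "nat \<Rightarrow> nat \<Rightarrow> nat \<Rightarrow> nat" where
  "ordinary_label k a j = inner_total + (m * (a * s + j) + shift (ascending a j) k)"

text \<open>Entries of the magic rectangle, placed right after all labels of ordinary edges.\<close>

definition cell :: "nat \<Rightarrow> nat \<Rightarrow> nat" where
  "cell \<rho> x = base + (\<rho> * (2 * h + 1) + magic_row h \<rho> x)"

definition spoke_label :: "nat \<Rightarrow> nat \<Rightarrow> nat \<Rightarrow> nat" where
  "spoke_label k a j = (if a < d then ordinary_label k a j else cell (a - d) (m * j + k))"

text \<open>For even \<open>m * s\<close> the column \<open>2 * h\<close> of the rectangle meets no vertex of the copies. Its entries
  go to the first three edges inside the core. They lie below \<open>base + 3 * (m * s) + 3\<close>, so the
  later edges continue the same enumeration in both cases.\<close>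

definition core_label :: "nat \<Rightarrow> nat \<Rightarrow> nat" where
  "core_label a b = (if even (m * s) \<and> colex a b < 3 then cell (colex a b) (2 * h)
                     else base + 3 * (m * s) + colex a b)"

definition label :: "nat \<times> nat \<times> nat \<Rightarrow> nat" where
  "label = (\<lambda>(k, a, b). Suc (if b < t then core_label a b
                             else if a < t then spoke_label k a (b - t)
                             else inner_label k (a - t) (b - t)))"

subsection \<open>Ranges\<close>

lemma shift_less: "k < m \<Longrightarrow> shift up k < m"
  by (auto simp: shift_def)

lemma shift_inject: "k < m \<Longrightarrow> k' < m \<Longrightarrow> shift up k = shift up k' \<Longrightarrow> k = k'"
  by (auto simp: shift_def split: if_splits)

lemma inner_label_less: "k < m \<Longrightarrow> i < j \<Longrightarrow> j < s \<Longrightarrow> inner_label k i j < inner_total"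
  using block_less[OF shift_less colex_less_choose, of k i j s _ 0] by (simp add: inner_label_def)

lemma ordinary_label_ge: "inner_total \<le> ordinary_label k a j"
  by (simp add: ordinary_label_def)

lemma spoke_index_less: "a < d \<Longrightarrow> j < s \<Longrightarrow> a * s + j < d * s"
proof -
  assume "a < d" "j < s"
  then have "a * s + j < (a + 1) * s" by simp
  also have "\<dots> \<le> d * s" using \<open>a < d\<close> by (intro mult_le_mono1) simp
  finally show ?thesis .
qed

lemma ordinary_label_less: "k < m \<Longrightarrow> a < d \<Longrightarrow> j < s \<Longrightarrow> ordinary_label k a j < base"
  using block_less[OF shift_less spoke_index_less, of k a j _ 0] by (simp add: ordinary_label_def)

lemma column_less: "k < m \<Longrightarrow> j < s \<Longrightarrow> m * j + k < m * s"
  using block_less[of k m j s 0] by simp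

lemma columns: "if even (m * s) then 2 * h = m * s else 2 * h + 1 = m * s"
  by (auto simp: h_def)

lemma column_le: "k < m \<Longrightarrow> j < s \<Longrightarrow> m * j + k \<le> 2 * h"
  using column_less[of k j] columns by (auto split: if_splits)

lemma cell_ge: "base \<le> cell \<rho> x"
  by (simp add: cell_def)

lemma cell_less_row:
  assumes "x \<le> 2 * h" "\<rho> < \<rho>'"
  shows "cell \<rho> x < cell \<rho>' y"
proof -
  have "\<rho> * (2 * h + 1) + magic_row h \<rho> x < (\<rho> + 1) * (2 * h + 1)"
    using magic_row_le[OF assms(1), of \<rho>] by simp
  also have "\<dots> \<le> \<rho>' * (2 * h + 1)"
    using assms by (intro mult_le_mono1) simp
  finally show ?thesis by (simp add: cell_def)
qed

lemma cell_less: "x \<le> 2 * h \<Longrightarrow> \<rho> < 3 \<Longrightarrow> cell \<rho> x < base + 3 * (2 * h + 1)"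
proof -
  assume "x \<le> 2 * h" "\<rho> < 3"
  then have "\<rho> * (2 * h + 1) + magic_row h \<rho> x < (\<rho> + 1) * (2 * h + 1)"
    using magic_row_le[of x h \<rho>] by simp
  also have "\<dots> \<le> 3 * (2 * h + 1)"
    using \<open>\<rho> < 3\<close> by (intro mult_le_mono1) simp
  finally show ?thesis by (simp add: cell_def)
qed

lemma cell_inject:
  assumes "x \<le> 2 * h" "y \<le> 2 * h" "cell \<rho> x = cell \<rho>' y"
  shows "\<rho> = \<rho>'" "x = y"
proof -
  show "\<rho> = \<rho>'"
    using assms cell_less_row[of x \<rho> \<rho>' y] cell_less_row[of y \<rho>' \<rho> x] by (metis nat_neq_iff)
  with assms show "x = y" by (auto simp: cell_def intro: magic_row_inject)
qed

lemma cell_sum: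
  "x \<le> 2 * h \<Longrightarrow> cell 0 x + cell 1 x + cell 2 x = 3 * base + 3 * (2 * h + 1) + 3 * h"
  using magic_row_sum[of x h] by (simp add: cell_def)

text \<open>The bound for large labels is the end of the rectangle: if \<open>m * s\<close> is even, the three extra
  entries of the rectangle are made up for by \<open>colex a b \<ge> 3\<close>.\<close>

lemma core_label_cases:
  obtains (hole) "even (m * s)" "colex a b < 3" "core_label a b = cell (colex a b) (m * s)" "2 * h = m * s"
  | (large) "base + 3 * (2 * h + 1) \<le> core_label a b" "core_label a b = base + 3 * (m * s) + colex a b"
proof (cases "even (m * s)")
  case True
  then have "2 * h = m * s" using columns by simp
  with True show ?thesis
    by (cases "colex a b < 3") (auto intro: hole large simp: core_label_def)
next
  case False
  then have "2 * h + 1 = m * s" using columns by simp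
  with False show ?thesis
    by (intro large) (simp_all only: core_label_def if_False simp_thms le_add1)
qed

lemma core_label_ge: "base \<le> core_label a b"
  by (auto simp: core_label_def cell_ge)

lemma core_label_neq_cell:
  assumes "x < m * s" "x \<le> 2 * h" "\<rho> < 3"
  shows "core_label a b \<noteq> cell \<rho> x"
  using assms cell_less[of x \<rho>] cell_inject(2)[of "m * s" x "colex a b" \<rho>]
  by (cases rule: core_label_cases[of a b]) auto

lemma core_label_mono:
  assumes "colex a b < colex a' b'"
  shows "core_label a b < core_label a' b'"
proof (cases rule: core_label_cases[of a b])
  case hole1: hole
  show ?thesis
  proof (cases rule: core_label_cases[of a' b'])
    case hole
    with hole1 assms show ?thesis by (simp add: cell_less_row)
  next
    case large
    with hole1 cell_less[of "m * s" "colex a b"] show ?thesis by simp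
  qed
next
  case large1: large
  show ?thesis
  proof (cases rule: core_label_cases[of a' b'])
    case hole
    with large1 assms show ?thesis by simp
  next
    case large
    with large1 assms show ?thesis by simp
  qed
qed

text \<open>The core has room for the three labels of an additional column, so no label exceeds the
  number of edges.\<close>

lemma six_le_core_edges: "6 \<le> t choose 2"
  using choose_two_mono[of 4 t] d_pos by (simp add: choose_two)

lemma core_label_less:
  assumes "a < b" "b < t"
  shows "core_label a b < base + 3 * (m * s) + (t choose 2)"
proof (cases rule: core_label_cases[of a b])
  case hole
  with six_le_core_edges cell_less[of "m * s" "colex a b"] show ?thesis by simp
next
  case large
  then show ?thesis using colex_less_choose[OF assms] by simp
qed

lemma spoke_label_less:
  assumes "k < m" "a < t" "j < s"
  shows "spoke_label k a j < base + 3 * (2 * h + 1)"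
proof (cases "a < d")
  case True
  with assms show ?thesis using ordinary_label_less[of k a j] by (simp add: spoke_label_def)
next
  case False
  with assms have "a - d < 3" by simp
  with False assms show ?thesis
    using cell_less[OF column_le, of k j "a - d"] by (simp add: spoke_label_def)
qed

subsection \<open>Bijectivity\<close>

lemma spoke_label_ge: "inner_total \<le> spoke_label k a j"
  using cell_ge[of "a - d" "m * j + k"] by (simp add: spoke_label_def ordinary_label_ge)

lemma spoke_neq_core:
  assumes "k < m" "a < t" "j < s"
  shows "spoke_label k a j \<noteq> core_label a' b'"
proof (cases "a < d")
  case True
  with assms show ?thesis
    using ordinary_label_less[of k a j] core_label_ge[of a' b'] by (simp add: spoke_label_def)
next
  case False
  with assms have "a - d < 3" by simp
  with False assms show ?thesis
    using core_label_neq_cell[OF column_less column_le, of k j "a - d" a' b']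
    by (auto simp: spoke_label_def)
qed

lemma inner_label_inject:
  assumes "k < m" "i < j" "k' < m" "i' < j'" "inner_label k i j = inner_label k' i' j'"
  shows "(k, i, j) = (k', i', j')"
proof -
  have "colex i j = colex i' j'" "shift (even (i + j)) k = shift (even (i' + j')) k'"
    using block_inject[OF shift_less shift_less] assms unfolding inner_label_def by metis+
  with assms show ?thesis using colex_inject shift_inject by blast
qed

lemma core_label_inject:
  assumes "a < b" "a' < b'" "core_label a b = core_label a' b'"
  shows "(a, b) = (a', b')"
proof -
  have "colex a b = colex a' b'"
    using core_label_mono[of a b a' b'] core_label_mono[of a' b' a b] assms(3)
    by (metis nat_neq_iff)
  with assms colex_inject show ?thesis by blast
qed

lemma spoke_label_inject:
  assumes "k < m" "a < t" "j < s" "k' < m" "a' < t" "j' < s"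
    and eq: "spoke_label k a j = spoke_label k' a' j'"
  shows "(k, a, j) = (k', a', j')"
proof -
  have less: "spoke_label k a j < spoke_label k' a' j'"
    if "k < m" "a < d" "j < s" "\<not> a' < d" for k a j k' a' j'
    using that ordinary_label_less[of k a j] cell_ge[of "a' - d" "m * j' + k'"]
    by (simp add: spoke_label_def)
  consider "a < d" "a' < d" | "d \<le> a" "d \<le> a'"
    using less[of k a j a' k' j'] less[of k' a' j' a k j] assms by (metis leI nat_neq_iff)
  then show ?thesis
  proof cases
    case 1
    then have *: "m * (a * s + j) + shift (ascending a j) k
        = m * (a' * s + j') + shift (ascending a' j') k'"
      using eq by (simp add: spoke_label_def ordinary_label_def)
    have "a * s + j = a' * s + j'" "shift (ascending a j) k = shift (ascending a' j') k'"
      using block_inject[OF shift_less shift_less *] assms by auto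
    \<comment> \<open>quotient and remainder of \<open>a * s + j\<close> by \<open>s\<close>\<close>
    moreover from this have "a = a'" "j = j'"
      using assms(3,6) s_pos
      by (metis div_less div_mult_self3 add.commute add_0_right nat_neq_iff not_less_zero,
          metis mod_less mod_mult_self3)
    ultimately show ?thesis using assms shift_inject by blast
  next
    case 2
    then have *: "cell (a - d) (m * j + k) = cell (a' - d) (m * j' + k')"
      using eq by (simp add: spoke_label_def)
    then have "a - d = a' - d" "m * j + k = m * j' + k'"
      using cell_inject[OF column_le column_le *] assms by auto
    then show ?thesis
      using 2 assms block_inject[of k m k' j j'] by auto
  qed
qed

lemma inj_on_label: "inj_on label (edge_codes m n t)"
proof (rule inj_onI)
  fix x y assume "x \<in> edge_codes m n t" "y \<in> edge_codes m n t" "label x = label y"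
  moreover obtain k a b k' a' b' where xy: "x = (k, a, b)" "y = (k', a', b')"
    by (cases x; cases y)
  ultimately have 1: "(k, a, b) \<in> edge_codes m n t" and 2: "(k', a', b') \<in> edge_codes m n t"
    and eq: "label (k, a, b) = label (k', a', b')"
    by simp_all
  have code: "k < m" "a < b" "b < n" "b < t \<Longrightarrow> k = 0"
    and code': "k' < m" "a' < b'" "b' < n" "b' < t \<Longrightarrow> k' = 0"
    using 1 2 by (auto simp: edge_codes_def)
  have kinds: "label (k, a, b) \<noteq> label (k', a', b')"
    if "k < m" "a < b" "b < n" "k' < m" "a' < b'" "b' < n" and
      kind: "b < t \<and> t \<le> b' \<or> t \<le> a \<and> a' < t \<and> t \<le> b'" for k a b k' a' b'
  proof (cases "b < t")
    case True
    with kind have "t \<le> b'" using \<open>a < b\<close> by auto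
    with True that spoke_neq_core[of k' a' "b' - t" a b] inner_label_less[of k' "a' - t" "b' - t"]
      core_label_ge[of a b]
    show ?thesis by (cases "a' < t") (auto simp: label_def copy_index_less copy_index_mono)
  next
    case False
    with that spoke_label_ge[of k' a' "b' - t"] inner_label_less[of k "a - t" "b - t"]
      copy_index_less[of b] copy_index_mono[of a b]
    show ?thesis by (auto simp: label_def)
  qed
  consider "b < t" "b' < t" | "a < t" "t \<le> b" "a' < t" "t \<le> b'" | "t \<le> a" "t \<le> a'"
    using kinds[of k a b k' a' b'] kinds[of k' a' b' k a b] code code' eq
    by (metis leI le_less_trans less_imp_le not_less)
  then have "k = k' \<and> a = a' \<and> b = b'"
  proof cases
    case 1
    then show ?thesis using eq code code' core_label_inject[of a b a' b'] by (simp add: label_def)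
  next
    case 2
    then have "k = k' \<and> a = a' \<and> b - t = b' - t"
      using eq code code' spoke_label_inject[of k a "b - t" k' a' "b' - t"]
        copy_index_less[of b] copy_index_less[of b']
      by (simp add: label_def)
    with 2 show ?thesis by (metis eq_diff_iff)
  next
    case 3
    then have "k = k' \<and> a - t = a' - t \<and> b - t = b' - t"
      using eq code code' inner_label_inject[of k "a - t" "b - t" k' "a' - t" "b' - t"]
        copy_index_mono[of a b] copy_index_mono[of a' b']
      by (simp add: label_def)
    moreover have "t \<le> b" "t \<le> b'"
      using 3 code code' by simp_all
    ultimately show ?thesis
      using 3 by (metis eq_diff_iff)
  qed
  then show "x = y" by (simp add: xy)
qed

lemma card_edge_codes: "card (edge_codes m n t) = base + 3 * (m * s) + (t choose 2)"
proof -
  define P where "P n = {(a, b). a < b \<and> b < n}" for n :: nat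
  have P: "finite (P n)" "card (P n) = n choose 2" for n
    unfolding P_def card_ordered_pairs
    by (auto intro: finite_subset[of _ "{..<n} \<times> {..<n}"])
  let ?f = "\<lambda>(k, i, j). (k, t + i, t + j)"
  have "edge_codes m n t
      = ({0} \<times> P t) \<union> ({..<m} \<times> {..<t} \<times> {t..<n}) \<union> ?f ` ({..<m} \<times> P s)" (is "_ = ?R")
  proof
    show "edge_codes m n t \<subseteq> ?R"
    proof
      fix x assume *: "x \<in> edge_codes m n t"
      obtain k a b where x: "x = (k, a, b)" by (cases x)
      show "x \<in> ?R"
      proof (cases "a < t")
        case True
        with * show ?thesis by (auto simp: x P_def edge_codes_def)
      next
        case False
        with * have "(k, a - t, b - t) \<in> {..<m} \<times> P s" "x = ?f (k, a - t, b - t)"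
          by (auto simp: x P_def edge_codes_def)
        then show ?thesis by blast
      qed
    qed
    show "?R \<subseteq> edge_codes m n t"
      using m_pos by (auto simp: P_def edge_codes_def)
  qed
  moreover have "({0} \<times> P t) \<inter> ({..<m} \<times> {..<t} \<times> {t..<n}) = {}"
    "(({0} \<times> P t) \<union> ({..<m} \<times> {..<t} \<times> {t..<n})) \<inter> ?f ` ({..<m} \<times> P s) = {}"
    by (auto simp: P_def)
  moreover have "inj_on ?f ({..<m} \<times> P s)"
    by (auto simp: inj_on_def)
  ultimately have "card (edge_codes m n t) = (t choose 2) + m * (t * s) + m * (s choose 2)"
    by (simp add: card_Un_disjoint card_image card_cartesian_product P)
  then show ?thesis by (simp add: algebra_simps)
qed

lemma label_range: "label ` edge_codes m n t \<subseteq> {1..card (edge_codes m n t)}"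
proof clarify
  fix k a b assume *: "(k, a, b) \<in> edge_codes m n t"
  have "label (k, a, b) \<le> base + 3 * (m * s) + (t choose 2)"
  proof -
    consider "b < t" | "a < t" "t \<le> b" | "t \<le> a" by linarith
    then show ?thesis
    proof cases
      case 1
      then show ?thesis using core_label_less[of a b] * by (auto simp: label_def edge_codes_def)
    next
      case 2
      moreover have "b - t < s" using * 2 by (auto simp: edge_codes_def)
      ultimately show ?thesis
        using spoke_label_less[of k a "b - t"] * columns six_le_core_edges
        by (auto simp: label_def edge_codes_def split: if_splits)
    next
      case 3
      then show ?thesis
        using inner_label_less[of k "a - t" "b - t"] * copy_index_less[of b] copy_index_mono[of a b]
        by (auto simp: label_def edge_codes_def)
    qed
  qed
  then show "label (k, a, b) \<in> {1..card (edge_codes m n t)}"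
    by (auto simp: card_edge_codes label_def)
qed

lemma bij_betw_label: "bij_betw label (edge_codes m n t) {1..card (edge_codes m n t)}"
proof -
  have "label ` edge_codes m n t = {1..card (edge_codes m n t)}"
    by (rule card_subset_eq[OF _ label_range]) (simp_all add: card_image[OF inj_on_label])
  then show ?thesis by (simp add: bij_betw_def inj_on_label)
qed

subsection \<open>Vertex sums\<close>

text \<open>The sum at vertex \<open>j\<close> of copy \<open>k\<close> without the three edges to the special core vertices, which
  contribute the same amount to all these sums.\<close>

definition copy_sum :: "nat \<Rightarrow> nat \<Rightarrow> nat" where
  "copy_sum k j = (\<Sum>a<d. Suc (ordinary_label k a j))
     + (\<Sum>i\<in>{..<s} - {j}. Suc (inner_label k (min i j) (max i j)))"

definition core_sum :: "nat \<Rightarrow> nat" where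
  "core_sum a = (\<Sum>b\<in>{..<t} - {a}. Suc (core_label (min a b) (max a b)))
     + (\<Sum>(k, j)\<in>{..<m} \<times> {..<s}. Suc (spoke_label k a j))"

lemma sum_split_copy:
  fixes f :: "nat \<Rightarrow> nat"
  assumes "j < s"
  shows "sum f ({..<n} - {t + j})
       = (\<Sum>a<d. f a) + (f d + f (d + 1) + f (d + 2)) + (\<Sum>i\<in>{..<s} - {j}. f (t + i))"
proof -
  \<comment> \<open>the ordinary core vertices, the special ones, and the rest of the copy\<close>
  have "{..<n} - {t + j} = ({..<d} \<union> {d, d + 1, d + 2}) \<union> (+) t ` ({..<s} - {j})" (is "?L = ?R")
  proof
    show "?L \<subseteq> ?R"
    proof
      fix x assume "x \<in> ?L"
      then have "x < t \<or> x = t + (x - t) \<and> x - t \<in> {..<s} - {j}" by auto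
      then show "x \<in> ?R" by (auto simp: less_Suc_eq eval_nat_numeral)
    qed
    show "?R \<subseteq> ?L" using assms by auto
  qed
  moreover have "sum f (({..<d} \<union> {d, d + 1, d + 2}) \<union> (+) t ` ({..<s} - {j}))
      = sum f ({..<d} \<union> {d, d + 1, d + 2}) + sum f ((+) t ` ({..<s} - {j}))"
    by (rule sum.union_disjoint) auto
  moreover have "sum f ({..<d} \<union> {d, d + 1, d + 2}) = sum f {..<d} + sum f {d, d + 1, d + 2}"
    by (rule sum.union_disjoint) auto
  moreover have "sum f ((+) t ` ({..<s} - {j})) = (\<Sum>i\<in>{..<s} - {j}. f (t + i))"
    by (simp add: sum.reindex)
  ultimately show ?thesis by simp
qed

lemma vertex_sum_copy_label:
  assumes "k < m" "j < s"
  shows "vertex_sum (amalgamation m n t) (code_labeling m n t label) (k, t + j)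
       = copy_sum k j + 3 * base + 9 * h + 6"
proof -
  let ?f = "\<lambda>a. sym_label label k a (t + j)"
  have "vertex_sum (amalgamation m n t) (code_labeling m n t label) (k, t + j)
      = sum ?f ({..<n} - {t + j})"
    using assms by (intro vertex_sum_copy) auto
  also have "\<dots> = (\<Sum>a<d. ?f a) + (?f d + ?f (d + 1) + ?f (d + 2))
      + (\<Sum>i\<in>{..<s} - {j}. ?f (t + i))"
    by (rule sum_split_copy) fact
  also have "(\<Sum>a<d. ?f a) = (\<Sum>a<d. Suc (ordinary_label k a j))"
    by (intro sum.cong) (auto simp: sym_label_def label_def spoke_label_def)
  also have "?f d + ?f (d + 1) + ?f (d + 2)
      = cell 0 (m * j + k) + cell 1 (m * j + k) + cell 2 (m * j + k) + 3"
    by (simp add: sym_label_def label_def spoke_label_def)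
  also have "\<dots> = 3 * base + 9 * h + 6"
    using cell_sum[OF column_le[OF assms]] by simp
  also have "(\<Sum>i\<in>{..<s} - {j}. ?f (t + i))
      = (\<Sum>i\<in>{..<s} - {j}. Suc (inner_label k (min i j) (max i j)))"
    by (intro sum.cong) (auto simp: sym_label_def label_def min_def max_def)
  finally show ?thesis by (simp add: copy_sum_def)
qed

lemma vertex_sum_core_label:
  assumes "a < t"
  shows "vertex_sum (amalgamation m n t) (code_labeling m n t label) (0, a) = core_sum a"
proof -
  have "vertex_sum (amalgamation m n t) (code_labeling m n t label) (0, a)
      = (\<Sum>b\<in>{..<t} - {a}. sym_label label 0 a b)
        + (\<Sum>(k, b)\<in>{..<m} \<times> {t..<n}. label (k, a, b))"
    using m_pos assms by (intro vertex_sum_core) auto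
  also have "(\<Sum>b\<in>{..<t} - {a}. sym_label label 0 a b)
      = (\<Sum>b\<in>{..<t} - {a}. Suc (core_label (min a b) (max a b)))"
    using assms by (intro sum.cong) (auto simp: sym_label_def label_def)
  also have "(\<Sum>(k, b)\<in>{..<m} \<times> {t..<n}. label (k, a, b))
      = (\<Sum>(k, j)\<in>{..<m} \<times> {..<s}. Suc (spoke_label k a j))"
    using assms
    by (intro sum.reindex_bij_witness[of _ "\<lambda>(k, j). (k, t + j)" "\<lambda>(k, b). (k, b - t)"])
       (auto simp: label_def)
  finally show ?thesis by (simp add: core_sum_def)
qed

definition sgn_of :: "bool \<Rightarrow> int" where
  "sgn_of up = (if up then 1 else - 1)"

lemma sgn_of_simps [simp]: "sgn_of True = 1" "sgn_of False = - 1"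
  by (simp_all add: sgn_of_def)

text \<open>Centered at the mean \<open>(m - 1) / 2\<close> of a class, ascending and descending places in copy \<open>k\<close> are
  opposite; doubling keeps this in the integers.\<close>

lemma shift_eq_sgn:
  assumes "k < m"
  shows "2 * int (shift up k) = (int m - 1) + sgn_of up * (2 * int k - (int m - 1))"
  using assms by (auto simp: shift_def sgn_of_def)

lemma sum_sgn_ascending:
  fixes e j :: nat
  shows
  "(\<Sum>a<e. sgn_of (ascending a j))
     = (if odd e then 1 else 0) + (if e \<ge> 2 \<and> odd s \<and> odd j then 2 else 0)"
  by (induction e) (auto simp: sgn_of_def ascending_def not_less_eq_eq)

lemma sum_sgn_even_add:
  fixes e j :: nat
  shows
  "(\<Sum>i<e. sgn_of (even (i + j))) = (if odd e then sgn_of (even j) else 0)"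
  by (induction e) (auto simp: sgn_of_def)

text \<open>For odd \<open>s\<close> and odd \<open>j\<close> the class at core vertex \<open>1\<close> is needed. It exists, since \<open>d\<close> is then even
  and positive.\<close>

lemma signs_balance:
  assumes "j < s"
  shows "(\<Sum>a<d. sgn_of (ascending a j)) + (\<Sum>i\<in>{..<s} - {j}. sgn_of (even (i + j))) = 0"
proof -
  have "(\<Sum>i<s. sgn_of (even (i + j)))
      = sgn_of (even (j + j)) + (\<Sum>i\<in>{..<s} - {j}. sgn_of (even (i + j)))"
    using assms by (intro sum.remove) auto
  moreover have "sgn_of (even (j + j)) = 1"
    by (simp add: sgn_of_def)
  ultimately have "(\<Sum>i\<in>{..<s} - {j}. sgn_of (even (i + j)))
      = (if odd s then sgn_of (even j) else 0) - 1"
    using sum_sgn_even_add[of j s] by linarith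
  moreover have "odd s \<Longrightarrow> 2 \<le> d"
    using parity d_pos by (cases d) (auto simp: Suc_le_eq intro: Nat.gr0I)
  ultimately show ?thesis
    using parity by (cases "odd s"; cases "odd j") (auto simp: sum_sgn_ascending)
qed

text \<open>The part of the sum that depends on \<open>k\<close> is a multiple of the sum of all signs.\<close>

lemma copy_sum_eq:
  assumes "k < m" "j < s"
  shows "copy_sum k j = copy_sum 0 j"
proof -
  define A where "A a = 2 * int (inner_total + m * (a * s + j) + 1) + (int m - 1)" for a
  define B where "B i = 2 * int (m * colex (min i j) (max i j) + 1) + (int m - 1)" for i
  have "2 * int (copy_sum k j) = (\<Sum>a<d. A a) + (\<Sum>i\<in>{..<s} - {j}. B i)" if k: "k < m" for k
  proof -
    define c where "c = 2 * int k - (int m - 1)"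
    have A: "2 * int (Suc (ordinary_label k a j)) = A a + sgn_of (ascending a j) * c" for a
      using shift_eq_sgn[OF k, of "ascending a j"]
      by (simp add: ordinary_label_def A_def c_def)
    have "even (min i j + max i j) = even (i + j)" for i
      by (auto simp: min_def max_def)
    then have B: "2 * int (Suc (inner_label k (min i j) (max i j)))
        = B i + sgn_of (even (i + j)) * c" for i
      using shift_eq_sgn[OF k, of "even (i + j)"]
      by (simp add: inner_label_def B_def c_def)
    have "2 * int (copy_sum k j) = (\<Sum>a<d. 2 * int (Suc (ordinary_label k a j)))
        + (\<Sum>i\<in>{..<s} - {j}. 2 * int (Suc (inner_label k (min i j) (max i j))))"
      by (simp only: copy_sum_def of_nat_add of_nat_sum sum_distrib_left distrib_left)
    also have "\<dots> = (\<Sum>a<d. A a) + (\<Sum>i\<in>{..<s} - {j}. B i)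
        + ((\<Sum>a<d. sgn_of (ascending a j)) + (\<Sum>i\<in>{..<s} - {j}. sgn_of (even (i + j)))) * c"
      by (simp only: A B sum.distrib sum_distrib_right distrib_right)
    finally show ?thesis by (simp only: signs_balance[OF assms(2)])
  qed
  from this[OF assms(1)] this[OF m_pos] show ?thesis by simp
qed

text \<open>Class for class, the edges at \<open>j\<close> come before those at \<open>j'\<close>. The ordinary core vertex \<open>0\<close> makes
  the inequality strict.\<close>

lemma copy_sum_mono:
  assumes "j < j'" "j' < s"
  shows "copy_sum 0 j < copy_sum 0 j'"
proof -
  have "(\<Sum>a<d. Suc (ordinary_label 0 a j)) < (\<Sum>a<d. Suc (ordinary_label 0 a j'))"
  proof (rule sum_strict_mono)
    show "Suc (ordinary_label 0 a j) < Suc (ordinary_label 0 a j')" for a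
      using block_less[OF shift_less[OF m_pos]] assms by (simp add: ordinary_label_def)
  qed (use d_pos in auto)
  moreover have "(\<Sum>i\<in>{..<s} - {j}. Suc (inner_label 0 (min i j) (max i j)))
      \<le> (\<Sum>i\<in>{..<s} - {j'}. Suc (inner_label 0 (min i j') (max i j')))"
  proof (rule sum_Diff_singleton_mono)
    fix i assume "i \<in> {..<s}" "i \<noteq> j" "i \<noteq> j'"
    then have "colex (min i j) (max i j) < colex (min i j') (max i j')"
      using colex_mono[of j j' i] assms by (simp add: min.commute max.commute)
    then show "Suc (inner_label 0 (min i j) (max i j)) \<le> Suc (inner_label 0 (min i j') (max i j'))"
      using block_less[OF shift_less[OF m_pos]] by (simp add: inner_label_def less_imp_le)
  qed (use assms in \<open>auto simp: min.commute max.commute\<close>)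
  ultimately show ?thesis by (simp add: copy_sum_def)
qed

lemma spoke_label_mono:
  assumes "k < m" "j < s" "a < a'" "a' < t"
  shows "spoke_label k a j < spoke_label k a' j"
proof -
  consider "a' < d" | "a < d" "d \<le> a'" | "d \<le> a" by linarith
  then show ?thesis
  proof cases
    case 1
    have "a * s + j < a' * s + j" using assms s_pos by simp
    with 1 show ?thesis
      using block_less[OF shift_less[OF assms(1)]] assms
      by (simp add: spoke_label_def ordinary_label_def)
  next
    case 2
    then show ?thesis
      using assms ordinary_label_less[of k a j] cell_ge[of "a' - d" "m * j + k"]
      by (simp add: spoke_label_def)
  next
    case 3
    then show ?thesis
      using assms cell_less_row[OF column_le[OF assms(1,2)], of "a - d" "a' - d"]
      by (simp add: spoke_label_def)
  qed
qed

lemma core_sum_mono: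
  assumes "a < a'" "a' < t"
  shows "core_sum a < core_sum a'"
proof -
  have "(\<Sum>(k, j)\<in>{..<m} \<times> {..<s}. Suc (spoke_label k a j))
      < (\<Sum>(k, j)\<in>{..<m} \<times> {..<s}. Suc (spoke_label k a' j))"
    using assms m_pos s_pos by (intro sum_strict_mono) (auto simp: spoke_label_mono)
  moreover have "(\<Sum>b\<in>{..<t} - {a}. Suc (core_label (min a b) (max a b)))
      \<le> (\<Sum>b\<in>{..<t} - {a'}. Suc (core_label (min a' b) (max a' b)))"
  proof (rule sum_Diff_singleton_mono)
    fix b assume "b \<noteq> a" "b \<noteq> a'"
    then show "Suc (core_label (min a b) (max a b)) \<le> Suc (core_label (min a' b) (max a' b))"
      using assms by (simp add: core_label_mono colex_mono less_imp_le)
  qed (use assms in \<open>auto simp: min.commute max.commute\<close>)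
  ultimately show ?thesis by (simp add: core_sum_def)
qed

text \<open>The bound is the column sum of the magic rectangle. If the first two core labels belong to the
  additional column, they are two of the three entries of a column, and the label of the third
  edge exceeds the missing entry.\<close>

lemma core_label_three:
  "3 * base + 9 * h + 3 < core_label 0 1 + core_label 0 2 + core_label 0 3"
proof -
  have colex: "colex 0 (Suc 0) = 0" "colex 0 2 = 1" "colex 0 3 = 3"
    by (simp_all add: colex_def eval_nat_numeral)
  have big: "base + 3 * (2 * h + 1) \<le> core_label 0 3"
    by (cases rule: core_label_cases[of 0 3]) (auto simp: colex)
  show ?thesis
  proof (cases rule: core_label_cases[of 0 1])
    case hole
    then have "core_label 0 1 = cell 0 (2 * h)" "core_label 0 2 = cell 1 (2 * h)"
      by (simp_all add: core_label_def colex)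
    then show ?thesis
      using cell_sum[of "2 * h"] cell_less[of "2 * h" 2] big by simp
  next
    case large
    have "core_label 0 1 < core_label 0 2"
      by (rule core_label_mono) (simp add: colex)
    moreover define L where "L = base + 3 * (2 * h + 1)"
    ultimately have "3 * L < core_label 0 1 + core_label 0 2 + core_label 0 3"
      using large(1) big by simp
    moreover have "3 * base + 9 * h + 3 \<le> 3 * L"
      by (simp add: L_def)
    ultimately show ?thesis by (rule le_less_trans[rotated])
  qed
qed

text \<open>Core vertex \<open>0\<close> has the smallest sum in the core. It is compared with vertex \<open>j\<close> of copy \<open>0\<close>,
  whose sum is the left-hand side, by pairing their edges. The edge between the two vertices counts
  for both. The edges inside the core from \<open>0\<close> to \<open>1, 2, 3\<close> outweigh the three special edges at
  \<open>j\<close>, and those to \<open>4, 5, \<dots>\<close> the other ordinary edges at \<open>j\<close>. The edges from \<open>0\<close> to the rest of copy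
  \<open>0\<close> outweigh the edges inside the copy at \<open>j\<close>.\<close>

lemma copy_sum_less_core_sum:
  assumes "j < s"
  shows "copy_sum 0 j + 3 * base + 9 * h + 6 < core_sum 0"
proof -
  let ?o = "\<lambda>k a j. Suc (ordinary_label k a j)"
  let ?c = "\<lambda>b. Suc (core_label 0 b)"
  have "(\<Sum>a<d. ?o 0 a j) = ?o 0 0 j + (\<Sum>a\<in>{1..<d}. ?o 0 a j)"
    using d_pos by (simp add: lessThan_atLeast0 sum.atLeast_Suc_lessThan)
  moreover have "(\<Sum>a\<in>{1..<d}. ?o 0 a j) \<le> (\<Sum>a\<in>{1..<d}. ?c (a + 3))"
  proof (rule sum_mono)
    fix a assume "a \<in> {1..<d}"
    then show "?o 0 a j \<le> ?c (a + 3)"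
      using ordinary_label_less[of 0 a j] core_label_ge[of 0 "a + 3"] m_pos assms by simp
  qed
  moreover have "(\<Sum>b\<in>{..<t} - {0}. Suc (core_label (min 0 b) (max 0 b)))
      = ?c 1 + ?c 2 + ?c 3 + (\<Sum>a\<in>{1..<d}. ?c (a + 3))"
  proof -
    have "{..<t} - {0} = {1, 2, 3} \<union> {1 + 3..<d + 3}"
      using d_pos by auto
    then have "(\<Sum>b\<in>{..<t} - {0}. ?c b) = sum ?c {1, 2, 3} + sum ?c {1 + 3..<d + 3}"
      by (simp only:) (rule sum.union_disjoint, auto)
    then show ?thesis
      by (simp only: sum.shift_bounds_nat_ivl) simp
  qed
  moreover have "?o 0 0 j + (\<Sum>i\<in>{..<s} - {j}. Suc (inner_label 0 (min i j) (max i j)))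
      \<le> (\<Sum>(k, j)\<in>{..<m} \<times> {..<s}. Suc (spoke_label k 0 j))"
  proof -
    have "(\<Sum>i\<in>{..<s} - {j}. Suc (inner_label 0 (min i j) (max i j)))
        \<le> (\<Sum>i\<in>{..<s} - {j}. ?o 0 0 i)"
    proof (rule sum_mono)
      fix i assume "i \<in> {..<s} - {j}"
      then have "inner_label 0 (min i j) (max i j) < inner_total"
        using assms m_pos by (intro inner_label_less) auto
      then show "Suc (inner_label 0 (min i j) (max i j)) \<le> ?o 0 0 i"
        using ordinary_label_ge[of 0 0 i] by simp
    qed
    then have "?o 0 0 j + (\<Sum>i\<in>{..<s} - {j}. Suc (inner_label 0 (min i j) (max i j)))
        \<le> (\<Sum>i<s. ?o 0 0 i)"
      using assms by (subst (2) sum.remove[of _ j]) auto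
    also have "\<dots> = (\<Sum>i<s. Suc (spoke_label 0 0 i))"
      using d_pos by (simp add: spoke_label_def)
    also have "\<dots> \<le> (\<Sum>k<m. \<Sum>i<s. Suc (spoke_label k 0 i))"
      using m_pos by (intro member_le_sum[of 0 _ "\<lambda>k. \<Sum>i<s. Suc (spoke_label k 0 i)"]) auto
    finally show ?thesis by (simp add: sum.cartesian_product)
  qed
  ultimately show ?thesis
    using core_label_three by (simp add: copy_sum_def core_sum_def)
qed

definition color :: "nat \<Rightarrow> nat" where
  "color a = (if a < t then core_sum a else copy_sum 0 (a - t) + 3 * base + 9 * h + 6)"

lemma inj_on_color: "inj_on color {..<n}"
proof (rule linorder_inj_onI)
  fix a b assume *: "a < b" "a \<in> {..<n}" "b \<in> {..<n}"
  have "core_sum 0 \<le> core_sum a" if "a < t"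
    using that core_sum_mono[of 0 a] by (cases "a = 0") auto
  moreover have "b - t < s" if "t \<le> b" "b < n"
    using that by (rule copy_index_less)
  moreover have "a - t < b - t" if "t \<le> a"
    using that \<open>a < b\<close> by (rule copy_index_mono)
  ultimately show "color a \<noteq> color b"
    using * core_sum_mono[of a b] copy_sum_mono[of "a - t" "b - t"]
      copy_sum_less_core_sum[of "b - t"]
    by (cases "a < t"; cases "b < t") (auto simp: color_def)
qed auto

lemma chi_la_amalgamation: "chi_la (amalgamation m n t) = n"
proof (rule chi_la_amalgamation_eqI[OF m_pos bij_betw_label _ inj_on_color])
  fix k a assume "(k, a) \<in> verts (amalgamation m n t)"
  then have *: "k < m" "a < n" "a < t \<longrightarrow> k = 0"
    by (auto simp: verts_amalgamation[OF m_pos])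
  show "vertex_sum (amalgamation m n t) (code_labeling m n t label) (k, a) = color a"
  proof (cases "a < t")
    case True
    with * show ?thesis by (simp add: vertex_sum_core_label color_def)
  next
    case False
    with * show ?thesis
      using vertex_sum_copy_label[of k "a - t"] copy_sum_eq[of k "a - t"] by (simp add: color_def)
  qed
qed

end

theorem corollary2p7:
  fixes m n r :: nat
  assumes "m \<ge> 2" and "odd n" and "r \<ge> 3" and "n > r"
  shows "chi_la (amalgamation m (n + 1) (r + 1)) =
           chi_la (join (amalgamation m n r) (complete_graph 1)) \<and>
         chi_la (join (amalgamation m n r) (complete_graph 1)) = n + 1"
proof -
  have params: "amalgam_labeling m (r - 2) (n - r)"
    using assms by unfold_locales auto
  have ar: "r - 2 + 3 = r + 1" "r + 1 + (n - r) = n + 1"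
    using assms by auto
  from amalgam_labeling.chi_la_amalgamation[OF params]
  have "chi_la (amalgamation m (n + 1) (r + 1)) = n + 1"
    by (simp only: ar)
  moreover have "chi_la (amalgamation m (n + 1) (r + 1))
      = chi_la (join (amalgamation m n r) (complete_graph 1))"
    using assms amalgamation_eq_map_graph_join[of m r n]
    by (simp add: chi_la_map_graph simple_join simple_amalgamation simple_complete_graph)
  ultimately show ?thesis by simp
qed

end
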